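(* Let $R$ be a local Noetherian integral domain with $\dim R\ge 1$, and let $I\subset R$ be an ideal. Then there exist infinitely many elements $b\in R$ such that $R(I)_{0,-b}$ is an integral domain.
   Context: The Rees algebra of a commutative ring $R$ with respect to an ideal $I$ is $\mathcal R_+=\bigoplus_{n\ge 0} I^nt^n\subseteq R[t]$. For $a,b\in R$, let $(I^2(t^2+at+b))$ denote the ideal $(t^2+at+b)R[t]\cap \mathcal R_+$ of $\mathcal R_+$, and set $R(I)_{a,b}=\mathcal R_+/(I^2(t^2+at+b))$; thus $R(I)_{0,-b}=\mathcal R_+/(I^2(t^2-b))$. Each element of $R(I)_{a,b}$ is uniquely represented by a polynomial $r+it$ with $r\in R$, $i\in I$. *)

theory Defs
  imports
    "HOL-Algebra.UnivPoly"
    "HOL-Algebra.Ideal_Product"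
    "HOL-Algebra.Ring_Divisibility"
    "HOL-Library.Extended_Nat"
begin

locale local_ring = cring +
  assumes unique_maximalideal: "\<exists>!M. maximalideal M R"

text \<open>
  Krull dimension: the supremum of the lengths \<open>n\<close> of strictly increasing chains
  \<open>P 0 \<subset> P 1 \<subset> \<dots> \<subset> P n\<close> of prime ideals.  Values of \<open>P\<close> beyond \<open>n\<close> are irrelevant; the
  zero ring, which has no such chain, gets dimension \<open>0\<close>.
\<close>

definition krull_dim :: "('a, 'b) ring_scheme \<Rightarrow> enat" where
  "krull_dim R = Sup {enat n | n. \<exists>P :: nat \<Rightarrow> 'a set.
     (\<forall>i\<le>n. primeideal (P i) R) \<and> (\<forall>i<n. P i \<subset> P (Suc i))}"

text \<open>
  The Rees algebra as a subring of \<open>R[t]\<close>.  The power \<open>I\<^sup>n\<close> is taken in the semiring of ideals,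
  whose product is the product of ideals and whose unit is \<open>carrier R\<close>, so that \<open>I\<^sup>0 = R\<close>.
\<close>

definition rees_algebra :: "('a, 'b) ring_scheme \<Rightarrow> 'a set \<Rightarrow> ('a, nat \<Rightarrow> 'a) up_ring" where
  "rees_algebra R I =
     (UP R)\<lparr>carrier := {p \<in> carrier (UP R).
        \<forall>n. coeff (UP R) p n \<in> I [^]\<^bsub>ideals_set R\<^esub> n}\<rparr>"

text \<open>The polynomial \<open>t\<^sup>2 + a t + b\<close>.\<close>

definition monic_quadratic :: "('a, 'b) ring_scheme \<Rightarrow> 'a \<Rightarrow> 'a \<Rightarrow> nat \<Rightarrow> 'a" where
  "monic_quadratic R a b =
     monom (UP R) \<one>\<^bsub>R\<^esub> 2 \<oplus>\<^bsub>UP R\<^esub> monom (UP R) a 1 \<oplus>\<^bsub>UP R\<^esub> monom (UP R) b 0"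

text \<open>
  The ideal \<open>(I\<^sup>2(t\<^sup>2 + a t + b))\<close> is the contraction to the Rees algebra of the ideal that the
  polynomial generates in \<open>R[t]\<close>; the polynomial itself need not lie in the Rees algebra.
\<close>

definition rees_ideal :: "('a, 'b) ring_scheme \<Rightarrow> 'a set \<Rightarrow> 'a \<Rightarrow> 'a \<Rightarrow> (nat \<Rightarrow> 'a) set" where
  "rees_ideal R I a b =
     (PIdl\<^bsub>UP R\<^esub> (monic_quadratic R a b)) \<inter> carrier (rees_algebra R I)"

text \<open>The ring \<open>R(I)\<^sub>a\<^sub>,\<^sub>b\<close>.\<close>

definition rees_quotient ::
    "('a, 'b) ring_scheme \<Rightarrow> 'a set \<Rightarrow> 'a \<Rightarrow> 'a \<Rightarrow> (nat \<Rightarrow> 'a) set ring" where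
  "rees_quotient R I a b = rees_algebra R I Quot rees_ideal R I a b"

end

theory Submission
  imports Defs "HOL-Algebra.Subrings"
begin

text \<open>
  Let \<open>K\<close> be the fraction field of \<open>R\<close>.  If \<open>b \<in> R\<close> is not a square in \<open>K\<close>, then \<open>t\<^sup>2 - b\<close> is
  irreducible over \<open>K\<close>, so the quotient of the Rees algebra by the contraction of \<open>(t\<^sup>2 - b)\<close> embeds
  into a domain (\<open>domain_rees_quotient\<close>).  If \<open>b\<close> is such an element and \<open>x\<close> is a nonzero nonunit, then
  the \<open>b x\<^sup>2\<^sup>n\<close> are infinitely many such elements.  What has to be shown is that not every element
  of \<open>R\<close> is a square in \<open>K\<close>.
  
  If every element of \<open>R\<close> were a square in \<open>K\<close>, then so would be every element of \<open>K\<close>, and a nonzero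
  element \<open>x\<close> of a prime ideal would have \<open>N\<close>-th roots in \<open>K\<close> for arbitrarily large \<open>N\<close>.  In a
  Noetherian domain this is impossible (\<open>root_degree_le\<close>).  Choose a prime \<open>P\<close> minimal over \<open>x\<close>; the
  length \<open>l\<close> of \<open>R\<^sub>P/xR\<^sub>P\<close> is finite (\<open>colength_le_exists\<close>), and \<open>R\<^sub>P/x\<^sup>mR\<^sub>P\<close> has length at most
  \<open>m l\<close> (\<open>colength_le_powers\<close>).  Suppose that \<open>y \<in> K\<close> satisfies \<open>y\<^sup>N = x\<close>, and let
  \<open>J = {r \<in> R. r R[y] \<subseteq> R}\<close>.  This is a nonzero ideal with \<open>y J \<subseteq> J\<close>, which gives a descending chain
  of ideals of \<open>R\<close>,
  
  \<open>J \<supseteq> yJ \<supseteq> y\<^sup>2J \<supseteq> \<dots> \<supseteq> y\<^sup>k\<^sup>NJ = x\<^sup>kJ\<close>.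
  
  No inclusion becomes an equality at \<open>P\<close>, since otherwise \<open>J = xJ\<close> at \<open>P\<close>, contrary to Nakayama's
  lemma.  By the ascending chain condition the ideals \<open>(J : x\<^sup>m)\<close> are constant from some index \<open>c\<close> on,
  whence \<open>J \<inter> x\<^sup>k\<^sup>+\<^sup>cR \<subseteq> x\<^sup>kJ\<close>, and therefore the \<open>kN\<close> inclusions remain strict modulo
  \<open>x\<^sup>k\<^sup>+\<^sup>cR\<close>.  Counting lengths, \<open>kN \<le> (k + c) l\<close> for every \<open>k\<close>, and so \<open>N \<le> l\<close>.
  
  The argument takes place inside \<open>R\<close>: an equation in \<open>K\<close> is multiplied out, and an inclusion
  \<open>A\<^sub>P \<subseteq> B\<^sub>P\<close> of localized ideals is expressed as \<open>A \<subseteq> saturation P B\<close>.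
\<close>

section \<open>Ideals of a commutative ring\<close>

context cring
begin

lemma cring_idealI:
  assumes "A \<subseteq> carrier R" and "\<zero> \<in> A"
    and add: "\<And>x y. x \<in> A \<Longrightarrow> y \<in> A \<Longrightarrow> x \<oplus> y \<in> A"
    and mult: "\<And>r x. r \<in> carrier R \<Longrightarrow> x \<in> A \<Longrightarrow> r \<otimes> x \<in> A"
  shows "ideal A R"
proof (rule idealI)
  show "ring R"
    by (rule ring_axioms)
  have neg: "\<ominus> x \<in> A" if "x \<in> A" for x
    using mult[of "\<ominus> \<one>" x] that assms(1) l_minus[of \<one> x] by auto
  show "subgroup A (add_monoid R)"
    by (rule add.subgroupI) (use assms neg in \<open>auto simp: a_inv_def\<close>)
  show "r \<otimes> x \<in> A" if "x \<in> A" "r \<in> carrier R" for x r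
    using mult that by blast
  show "x \<otimes> r \<in> A" if "x \<in> A" "r \<in> carrier R" for x r
    using mult[of r x] that assms(1) m_comm[of x r] by auto
qed

lemma ideal_diff_closed:
  assumes "ideal A R" "x \<in> A" "y \<in> A"
  shows "x \<ominus> y \<in> A"
  using assms unfolding a_minus_def
  by (simp add: additive_subgroup.a_closed additive_subgroup.a_inv_closed ideal.axioms(1))

lemma add_diff_cancel:
  assumes "x \<in> carrier R" "y \<in> carrier R"
  shows "(x \<oplus> y) \<ominus> x = y"
  using assms by (simp add: a_minus_def a_comm[of x y] a_assoc r_neg)

lemma ideal_add_closed: "ideal A R \<Longrightarrow> x \<in> A \<Longrightarrow> y \<in> A \<Longrightarrow> x \<oplus> y \<in> A"
  by (simp add: additive_subgroup.a_closed ideal.axioms(1))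

lemma ideal_zero_closed: "ideal A R \<Longrightarrow> \<zero> \<in> A"
  by (simp add: additive_subgroup.zero_closed ideal.axioms(1))

definition colon :: "'a set \<Rightarrow> 'a \<Rightarrow> 'a set" where
  "colon A u = {r \<in> carrier R. u \<otimes> r \<in> A}"

lemma ideal_colon:
  assumes A: "ideal A R" and u: "u \<in> carrier R"
  shows "ideal (colon A u) R"
proof (rule cring_idealI)
  show "x \<oplus> y \<in> colon A u" if "x \<in> colon A u" "y \<in> colon A u" for x y
    using that ideal_add_closed[OF A, of "u \<otimes> x" "u \<otimes> y"] u by (auto simp: colon_def r_distr)
  show "r \<otimes> x \<in> colon A u" if "r \<in> carrier R" "x \<in> colon A u" for r x
    using that ideal.I_l_closed[OF A, of "u \<otimes> x" r] u by (auto simp: colon_def m_lcomm)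
qed (use assms ideal_zero_closed in \<open>auto simp: colon_def\<close>)

lemma mem_PIdl_iff:
  "u \<in> carrier R \<Longrightarrow> x \<in> PIdl u \<longleftrightarrow> (\<exists>r\<in>carrier R. x = u \<otimes> r)"
  by (auto simp: cgenideal_def m_comm)

definition adjoin :: "'a set \<Rightarrow> 'a \<Rightarrow> 'a set" where
  "adjoin A u = {a \<oplus> u \<otimes> r | a r. a \<in> A \<and> r \<in> carrier R}"

lemma ideal_adjoin:
  assumes "ideal A R" "u \<in> carrier R"
  shows "ideal (adjoin A u) R"
proof -
  have PI: "PIdl u = {u \<otimes> r | r. r \<in> carrier R}"
    using mem_PIdl_iff[OF assms(2)] by blast
  have "adjoin A u = set_add R A (PIdl u)"
    unfolding adjoin_def set_add_def' PI by blast
  then show ?thesis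
    using add_ideals[OF assms(1) cgenideal_ideal[OF assms(2)]] by simp
qed

lemma subset_adjoin:
  assumes "ideal A R" "u \<in> carrier R"
  shows "A \<subseteq> adjoin A u" "u \<in> adjoin A u"
proof -
  have "x \<in> adjoin A u" if "x \<in> A" for x
    unfolding adjoin_def mem_Collect_eq using that ideal.Icarr[OF assms(1)] assms(2)
    by (intro exI[of _ x] exI[of _ \<zero>]) auto
  then show "A \<subseteq> adjoin A u"
    by blast
  show "u \<in> adjoin A u"
    unfolding adjoin_def mem_Collect_eq using ideal_zero_closed[OF assms(1)] assms(2)
    by (intro exI[of _ \<zero>] exI[of _ \<one>]) auto
qed

section \<open>Lengths after localizing at a prime ideal\<close>

text \<open>
  For a prime \<open>P\<close> this is the preimage in \<open>R\<close> of the localized ideal \<open>A\<^sub>P\<close>, which makes it possible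
  to compare ideals at \<open>P\<close> without a localized ring.
\<close>

definition saturation :: "'a set \<Rightarrow> 'a set \<Rightarrow> 'a set" where
  "saturation P A = {r \<in> carrier R. \<exists>s \<in> carrier R - P. s \<otimes> r \<in> A}"

text \<open>
  The length of \<open>R\<^sub>P/A\<^sub>P\<close> is at most \<open>l\<close>.  The steps of a descending sequence that stay strict at \<open>P\<close>
  are counted, instead of requiring all steps to be strict, because sums and colon ideals turn a
  strict sequence into one that may be stationary in places.
\<close>

definition colength_le :: "'a set \<Rightarrow> 'a set \<Rightarrow> nat \<Rightarrow> bool" where
  "colength_le P A l \<longleftrightarrow> (\<forall>L. (\<forall>i. ideal (L i) R \<and> A \<subseteq> L i \<and> L (Suc i) \<subseteq> L i) \<longrightarrow>
     (\<forall>n::nat. card {i. i < n \<and> \<not> L i \<subseteq> saturation P (L (Suc i))} \<le> l))"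

lemma colength_leD:
  assumes "colength_le P A l" "\<And>i. ideal (L i) R" "\<And>i. A \<subseteq> L i" "\<And>i. L (Suc i) \<subseteq> L i"
  shows "card {i. i < n \<and> \<not> L i \<subseteq> saturation P (L (Suc i))} \<le> l"
  using assms unfolding colength_le_def by blast

lemma colength_le_mono:
  assumes "colength_le P A l" "A \<subseteq> B"
  shows "colength_le P B l"
  unfolding colength_le_def
proof (intro allI impI)
  fix L and n :: nat assume "\<forall>i. ideal (L i) R \<and> B \<subseteq> L i \<and> L (Suc i) \<subseteq> L i"
  with assms(2) show "card {i. i < n \<and> \<not> L i \<subseteq> saturation P (L (Suc i))} \<le> l"
    by (intro colength_leD[OF assms(1)]) auto
qed

lemma subset_saturation:
  assumes P: "primeideal P R" and "A \<subseteq> carrier R"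
  shows "A \<subseteq> saturation P A"
proof -
  have "\<one> \<in> carrier R - P"
    using P ideal.one_imp_carrier primeideal.I_notcarr primeideal.axioms(1) by fastforce
  moreover have "\<one> \<otimes> a \<in> A" if "a \<in> A" for a
    using that assms(2) by auto
  ultimately show ?thesis
    unfolding saturation_def using assms(2) by blast
qed

lemma colength_le_carrier: "colength_le P (carrier R) 0" if P: "primeideal P R"
  unfolding colength_le_def
proof (intro allI impI)
  fix L n assume L: "\<forall>i. ideal (L i) R \<and> carrier R \<subseteq> L i \<and> L (Suc i) \<subseteq> L i"
  have "L i \<subseteq> saturation P (L (Suc i))" for i
  proof -
    have "L i \<subseteq> carrier R" "L (Suc i) \<subseteq> carrier R" "carrier R \<subseteq> L (Suc i)"
      using L ideal.Icarr[of "L _" R] by auto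
    then show ?thesis
      using subset_saturation[OF P, of "L (Suc i)"] by auto
  qed
  then show "card {i. i < n \<and> \<not> L i \<subseteq> saturation P (L (Suc i))} \<le> 0"
    by simp
qed

lemma prime_complement_mult:
  assumes "primeideal P R" "s \<in> carrier R - P" "t \<in> carrier R - P"
  shows "s \<otimes> t \<in> carrier R - P"
  using assms primeideal.I_prime by fastforce

lemma saturation_mono: "A \<subseteq> B \<Longrightarrow> saturation P A \<subseteq> saturation P B"
  unfolding saturation_def by blast

lemma saturation_saturation:
  assumes "primeideal P R"
  shows "saturation P (saturation P A) \<subseteq> saturation P A"
proof
  fix r assume "r \<in> saturation P (saturation P A)"
  then obtain s t where "r \<in> carrier R" "s \<in> carrier R - P" "t \<in> carrier R - P"
    "t \<otimes> (s \<otimes> r) \<in> A"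
    unfolding saturation_def by blast
  then show "r \<in> saturation P A"
    unfolding saturation_def
    using prime_complement_mult[OF assms, of t s] by (auto simp: m_assoc intro!: bexI[of _ "t \<otimes> s"])
qed

lemma ideal_saturation:
  assumes P: "primeideal P R" and A: "ideal A R"
  shows "ideal (saturation P A) R"
proof (rule cring_idealI)
  show "\<zero> \<in> saturation P A"
    using subset_saturation[OF P, of A] ideal_zero_closed[OF A] ideal.Icarr[OF A] by blast
next
  fix x y assume "x \<in> saturation P A" "y \<in> saturation P A"
  then obtain s t where st: "s \<in> carrier R - P" "t \<in> carrier R - P" "x \<in> carrier R" "y \<in> carrier R"
    "s \<otimes> x \<in> A" "t \<otimes> y \<in> A"
    unfolding saturation_def by blast
  have "t \<otimes> (s \<otimes> x) \<oplus> s \<otimes> (t \<otimes> y) \<in> A"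
    using st by (simp add: ideal_add_closed[OF A] ideal.I_l_closed[OF A])
  moreover have "t \<otimes> (s \<otimes> x) \<oplus> s \<otimes> (t \<otimes> y) = (s \<otimes> t) \<otimes> (x \<oplus> y)"
    using st by (simp add: r_distr m_ac)
  ultimately show "x \<oplus> y \<in> saturation P A"
    unfolding saturation_def using prime_complement_mult[OF P st(1,2)] st by force
next
  fix r x assume r: "r \<in> carrier R" and "x \<in> saturation P A"
  then obtain s where s: "s \<in> carrier R - P" "x \<in> carrier R" "s \<otimes> x \<in> A"
    unfolding saturation_def by blast
  then have "r \<otimes> (s \<otimes> x) \<in> A"
    using r by (simp add: ideal.I_l_closed[OF A])
  then have "s \<otimes> (r \<otimes> x) \<in> A"
    using r s by (simp add: m_ac)
  then show "r \<otimes> x \<in> saturation P A"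
    unfolding saturation_def using r s(1,2) by auto
qed (auto simp: saturation_def)

text \<open>
  Additivity of length along the exact sequence
  \<open>0 \<rightarrow> R/(A : u) \<rightarrow> R/A \<rightarrow> R/(A + uR) \<rightarrow> 0\<close>.  As in the modular law, a step of a chain that becomes
  an equality at \<open>P\<close> both after adding \<open>uR\<close> and after taking the colon by \<open>u\<close> was already an
  equality at \<open>P\<close>.
\<close>

lemma colength_le_add:
  assumes P: "primeideal P R" and A: "ideal A R" and u: "u \<in> carrier R"
    and sum: "colength_le P (adjoin A u) k" and col: "colength_le P (colon A u) l"
  shows "colength_le P A (k + l)"
  unfolding colength_le_def
proof (intro allI impI)
  fix L n assume *: "\<forall>i. ideal (L i) R \<and> A \<subseteq> L i \<and> L (Suc i) \<subseteq> L i"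
  then have L: "\<And>i. ideal (L i) R" "\<And>i. A \<subseteq> L i" "\<And>i. L (Suc i) \<subseteq> L i"
    by blast+
  have Lc: "L i \<subseteq> carrier R" for i
    using L(1) ideal.Icarr by fast
  define J where "J M = {i. i < n \<and> \<not> M i \<subseteq> saturation P (M (Suc i))}" for M :: "nat \<Rightarrow> 'a set"
  have "J L \<subseteq> J (\<lambda>i. adjoin (L i) u) \<union> J (\<lambda>i. colon (L i) u)"
  proof (rule ccontr)
    assume "\<not> ?thesis"
    then obtain i where i: "i < n" "\<not> L i \<subseteq> saturation P (L (Suc i))"
      and 1: "adjoin (L i) u \<subseteq> saturation P (adjoin (L (Suc i)) u)"
      and 2: "colon (L i) u \<subseteq> saturation P (colon (L (Suc i)) u)"
      unfolding J_def by blast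
    have "e \<in> saturation P (L (Suc i))" if e: "e \<in> L i" for e
    proof -
      have "e \<in> saturation P (adjoin (L (Suc i)) u)"
        using 1 e subset_adjoin(1)[OF L(1) u] by blast
      then obtain s l r where s: "s \<in> carrier R - P" "l \<in> L (Suc i)" "r \<in> carrier R"
        and se: "s \<otimes> e = l \<oplus> u \<otimes> r"
        unfolding saturation_def adjoin_def by blast
      have c: "l \<in> carrier R" "e \<in> carrier R"
        using s(2) e Lc by blast+
      have "s \<otimes> e \<ominus> l \<in> L i"
        using s e L(3) by (intro ideal_diff_closed[OF L(1)] ideal.I_l_closed[OF L(1)]) auto
      moreover have "s \<otimes> e \<ominus> l = u \<otimes> r"
        unfolding se using c s u by (intro add_diff_cancel) auto
      ultimately have "r \<in> colon (L i) u"
        using s by (simp add: colon_def)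
      then have "r \<in> saturation P (colon (L (Suc i)) u)"
        using 2 by blast
      then obtain t where t: "t \<in> carrier R - P" "u \<otimes> (t \<otimes> r) \<in> L (Suc i)"
        unfolding saturation_def colon_def by blast
      have "t \<otimes> l \<oplus> u \<otimes> (t \<otimes> r) \<in> L (Suc i)"
        using t s by (simp add: ideal_add_closed[OF L(1)] ideal.I_l_closed[OF L(1)])
      moreover have "t \<otimes> l \<oplus> u \<otimes> (t \<otimes> r) = t \<otimes> (s \<otimes> e)"
        unfolding se using t c s u by (simp add: r_distr m_ac)
      ultimately have "(t \<otimes> s) \<otimes> e \<in> L (Suc i)"
        using t s c by (simp add: m_assoc)
      then show ?thesis
        unfolding saturation_def using c prime_complement_mult[OF P t(1) s(1)] by blast
    qed
    with i show False
      by blast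
  qed
  then have "card (J L) \<le> card (J (\<lambda>i. adjoin (L i) u) \<union> J (\<lambda>i. colon (L i) u))"
    by (intro card_mono) (auto simp: J_def)
  also have "\<dots> \<le> card (J (\<lambda>i. adjoin (L i) u)) + card (J (\<lambda>i. colon (L i) u))"
    by (rule card_Un_le)
  also have "card (J (\<lambda>i. adjoin (L i) u)) \<le> k"
    unfolding J_def
  proof (rule colength_leD[OF sum])
    show "adjoin A u \<subseteq> adjoin (L i) u" for i
      using L(2)[of i] unfolding adjoin_def by blast
    show "adjoin (L (Suc i)) u \<subseteq> adjoin (L i) u" for i
      using L(3)[of i] unfolding adjoin_def by blast
    show "ideal (adjoin (L i) u) R" for i
      by (intro ideal_adjoin L(1) u)
  qed
  also have "card (J (\<lambda>i. colon (L i) u)) \<le> l"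
    unfolding J_def
  proof (rule colength_leD[OF col])
    show "colon A u \<subseteq> colon (L i) u" for i
      using L(2)[of i] unfolding colon_def by blast
    show "colon (L (Suc i)) u \<subseteq> colon (L i) u" for i
      using L(3)[of i] unfolding colon_def by blast
    show "ideal (colon (L i) u) R" for i
      by (intro ideal_colon L(1) u)
  qed
  finally show "card {i. i < n \<and> \<not> L i \<subseteq> saturation P (L (Suc i))} \<le> k + l"
    unfolding J_def by simp
qed

lemma saturation_eq_carrier:
  assumes "primeideal P R" "ideal A R" "\<not> A \<subseteq> P"
  shows "saturation P A = carrier R"
proof -
  obtain s where "s \<in> A" "s \<notin> P"
    using assms(3) by blast
  then show ?thesis
    unfolding saturation_def using ideal.I_r_closed[OF assms(2)] ideal.Icarr[OF assms(2)] by blast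
qed

text \<open>
  Ideals not contained in \<open>P\<close> become the unit ideal at \<open>P\<close>.  So a chain above \<open>A\<close> can only be strict
  at \<open>P\<close> where it enters \<open>P\<close>, and it can enter only if \<open>A = P\<close>.
\<close>

lemma colength_le_prime:
  assumes P: "primeideal P R" and A: "ideal A R" and "A \<subseteq> P \<Longrightarrow> A = P"
  shows "colength_le P A 1"
  unfolding colength_le_def
proof (intro allI impI)
  fix L and n :: nat assume *: "\<forall>i. ideal (L i) R \<and> A \<subseteq> L i \<and> L (Suc i) \<subseteq> L i"
  then have L: "\<And>i. ideal (L i) R" "\<And>i. A \<subseteq> L i" "\<And>i. L (Suc i) \<subseteq> L i"
    by blast+
  have mono: "L j \<subseteq> L i" if "i \<le> j" for i j
    using lift_Suc_antimono_le[of L, OF L(3)] that .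
  have Lc: "L i \<subseteq> carrier R" for i
    using L(1) ideal.Icarr by fast
  let ?J = "{i. i < n \<and> \<not> L i \<subseteq> saturation P (L (Suc i))}"
  have jump: "L (Suc i) \<subseteq> P" "\<not> L i \<subseteq> P" if "i \<in> ?J" for i
  proof -
    show 1: "L (Suc i) \<subseteq> P"
      using that saturation_eq_carrier[OF P L(1), of "Suc i"] Lc by blast
    then have "A = P"
      using assms(3) L(2) by blast
    then show "\<not> L i \<subseteq> P"
      using that subset_saturation[OF P Lc, of "Suc i"] L(2)[of "Suc i"] by blast
  qed
  have "i = j" if "i \<in> ?J" "j \<in> ?J" for i j
  proof (rule ccontr)
    assume "i \<noteq> j"
    then consider "Suc i \<le> j" | "Suc j \<le> i"
      by linarith
    then show False
      using jump that mono by cases blast+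
  qed
  then have "card ?J \<le> Suc 0"
    using card_le_Suc0_iff_eq[of ?J] by auto
  then show "card ?J \<le> 1"
    by simp
qed

text \<open>
  Induction on \<open>m\<close> by additivity with \<open>A = x\<^sup>m\<^sup>+\<^sup>1R\<close> and \<open>u = x\<^sup>m\<close>: the sum is \<open>x\<^sup>mR\<close>, and the colon
  ideal contains \<open>x\<close>.
\<close>

lemma colength_le_powers:
  assumes P: "primeideal P R" and x: "x \<in> carrier R" and l: "colength_le P (PIdl x) l"
  shows "colength_le P (PIdl (x [^] (m::nat))) (m * l)"
proof (induction m)
  case 0
  have "PIdl \<one> = carrier R"
    using ideal_eq_carrier_iff[of \<one>] by simp
  then show ?case
    using colength_le_carrier[OF P] by simp
next
  case (Suc m)
  have "colength_le P (PIdl (x [^] Suc m)) (m * l + l)"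
  proof (rule colength_le_add[OF P])
    show "x [^] m \<in> carrier R" "ideal (PIdl (x [^] Suc m)) R"
      using x by (simp_all add: cgenideal_ideal)
    then have "PIdl (x [^] m) \<subseteq> adjoin (PIdl (x [^] Suc m)) (x [^] m)"
      by (intro cgenideal_minimal subset_adjoin ideal_adjoin)
    then show "colength_le P (adjoin (PIdl (x [^] Suc m)) (x [^] m)) (m * l)"
      using colength_le_mono[OF Suc] by blast
    have "PIdl x \<subseteq> colon (PIdl (x [^] Suc m)) (x [^] m)"
      using x by (auto simp: colon_def mem_PIdl_iff m_assoc)
    then show "colength_le P (colon (PIdl (x [^] Suc m)) (x [^] m)) l"
      using colength_le_mono[OF l] by blast
  qed
  then show ?case
    by (simp add: add.commute)
qed

end

section \<open>Minimal primes and the maximal condition\<close>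

context cring
begin

text \<open>
  The intersection of a nonempty chain of prime ideals is prime, so Zorn's lemma applies.  It is used
  for the complements of the primes, which turns minimal primes into maximal elements.
\<close>

lemma minimal_prime_exists:
  assumes "primeideal P0 R" "x \<in> P0"
  obtains P where "primeideal P R" "x \<in> P"
    "\<And>Q. primeideal Q R \<Longrightarrow> x \<in> Q \<Longrightarrow> Q \<subseteq> P \<Longrightarrow> Q = P"
proof -
  define \<S> where "\<S> = {carrier R - Q | Q. primeideal Q R \<and> x \<in> Q}"
  have "\<exists>M\<in>\<S>. \<forall>X\<in>\<S>. M \<subseteq> X \<longrightarrow> X = M"
  proof (rule subset_Zorn_nonempty)
    show "\<S> \<noteq> {}"
      unfolding \<S>_def using assms by blast
  next
    fix C assume C: "C \<noteq> {}" "subset.chain \<S> C"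
    define Q where "Q = carrier R - \<Union>C"
    have D: "D \<subseteq> carrier R" "primeideal (carrier R - D) R" "x \<in> carrier R - D" if "D \<in> C" for D
    proof -
      have "D \<in> \<S>"
        using C(2) that unfolding pred_on.chain_def by blast
      then obtain Q' where Q': "primeideal Q' R" "x \<in> Q'" "D = carrier R - Q'"
        unfolding \<S>_def by blast
      then have "Q' \<subseteq> carrier R"
        using ideal.Icarr primeideal.axioms(1) by fast
      then have "carrier R - D = Q'"
        using Q'(3) by blast
      then show "D \<subseteq> carrier R" "primeideal (carrier R - D) R" "x \<in> carrier R - D"
        using Q' by auto
    qed
    have Di: "ideal (carrier R - D) R" if "D \<in> C" for D
      using D(2)[OF that] primeideal.axioms(1) by blast
    have mem: "r \<in> Q \<longleftrightarrow> r \<in> carrier R \<and> (\<forall>D\<in>C. r \<in> carrier R - D)" for r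
      unfolding Q_def by blast
    have "primeideal Q R"
    proof (rule primeidealI)
      show "ideal Q R"
      proof (rule cring_idealI)
        show "\<zero> \<in> Q"
          unfolding mem using Di ideal_zero_closed by blast
        show "r \<oplus> s \<in> Q" if "r \<in> Q" "s \<in> Q" for r s
          using that unfolding mem using Di ideal_add_closed[of "carrier R - D" r s for D] by simp
        show "r \<otimes> s \<in> Q" if "r \<in> carrier R" "s \<in> Q" for r s
          using that unfolding mem using Di ideal.I_l_closed[of "carrier R - D" R s r for D] by simp
      qed (auto simp: Q_def)
      obtain D0 where "D0 \<in> C"
        using C(1) by blast
      then show "carrier R \<noteq> Q"
        using D(2)[of D0] primeideal.I_notcarr[of "carrier R - D0" R] mem by blast
      fix r s assume rs: "r \<in> carrier R" "s \<in> carrier R" "r \<otimes> s \<in> Q"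
      show "r \<in> Q \<or> s \<in> Q"
      proof (rule ccontr)
        assume "\<not> ?thesis"
        then obtain D1 D2 where "D1 \<in> C" "D2 \<in> C" "r \<in> D1" "s \<in> D2"
          using rs unfolding Q_def by blast
        moreover then have "D1 \<subseteq> D2 \<or> D2 \<subseteq> D1"
          using C(2) unfolding pred_on.chain_def by blast
        ultimately obtain D' where D': "D' \<in> C" "r \<in> D'" "s \<in> D'"
          by blast
        then show False
          using primeideal.I_prime[OF D(2)[OF D'(1)] rs(1,2)] rs(3) unfolding mem by blast
      qed
    qed (rule cring_axioms)
    moreover have "x \<in> Q"
      unfolding mem using D(3) C(1) by blast
    moreover have "\<Union>C = carrier R - Q"
      unfolding Q_def using D(1) by blast
    ultimately show "\<Union>C \<in> \<S>"
      unfolding \<S>_def by blast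
  qed
  then obtain P where P: "primeideal P R" "x \<in> P"
    and max: "\<And>Q. primeideal Q R \<Longrightarrow> x \<in> Q \<Longrightarrow> carrier R - P \<subseteq> carrier R - Q \<Longrightarrow>
      carrier R - Q = carrier R - P"
    unfolding \<S>_def by blast
  show thesis
  proof (rule that[OF P])
    fix Q assume Q: "primeideal Q R" "x \<in> Q" "Q \<subseteq> P"
    then have "carrier R - Q = carrier R - P"
      by (intro max) auto
    moreover have "P \<subseteq> carrier R"
      using P(1) ideal.Icarr primeideal.axioms(1) by fast
    ultimately show "Q = P"
      using Q(3) by blast
  qed
qed

end

context noetherian_ring
begin

text \<open>
  The union of a nonempty chain of ideals of a Noetherian ring is a member of the chain, so that
  Zorn's lemma applies to any nonempty family of ideals.
\<close>

lemma maximal_ideal_in_family: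
  assumes "\<A> \<noteq> {}" "\<And>A. A \<in> \<A> \<Longrightarrow> ideal A R"
  obtains M where "M \<in> \<A>" "\<And>A. A \<in> \<A> \<Longrightarrow> M \<subseteq> A \<Longrightarrow> A = M"
proof -
  have "\<exists>M\<in>\<A>. \<forall>X\<in>\<A>. M \<subseteq> X \<longrightarrow> X = M"
  proof (rule subset_Zorn_nonempty[OF assms(1)])
    fix C assume "C \<noteq> {}" and C: "subset.chain \<A> C"
    moreover have "subset.chain {I. ideal I R} C"
      using C assms(2) unfolding pred_on.chain_def by blast
    ultimately have "\<Union>C \<in> C"
      by (intro ideal_chain_is_trivial)
    then show "\<Union>C \<in> \<A>"
      using C unfolding pred_on.chain_def by blast
  qed
  then show thesis
    using that by blast
qed

end

context noetherian_domain
begin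

text \<open>
  Noetherian induction.  Additivity shows that an ideal maximal among those of infinite colength at
  \<open>P\<close> is prime: if \<open>u v \<in> M\<close> with \<open>u, v \<notin> M\<close>, then \<open>M + uR\<close> and \<open>(M : u)\<close> are strictly larger than
  \<open>M\<close>.  But primes containing \<open>x\<close> have colength at most one at \<open>P\<close>, by minimality of \<open>P\<close>.
\<close>

lemma colength_le_exists:
  assumes P: "primeideal P R" and x: "x \<in> carrier R"
    and min: "\<And>Q. primeideal Q R \<Longrightarrow> x \<in> Q \<Longrightarrow> Q \<subseteq> P \<Longrightarrow> Q = P"
  shows "\<exists>l. colength_le P (PIdl x) l"
proof (rule ccontr)
  assume no: "\<not> ?thesis"
  define \<A> where "\<A> = {A. ideal A R \<and> x \<in> A \<and> (\<nexists>l. colength_le P A l)}"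
  have "PIdl x \<in> \<A>"
    unfolding \<A>_def using no x by (simp add: cgenideal_ideal cgenideal_self)
  then obtain M where "M \<in> \<A>" and max: "\<And>A. A \<in> \<A> \<Longrightarrow> M \<subseteq> A \<Longrightarrow> A = M"
    using maximal_ideal_in_family[of \<A>] unfolding \<A>_def by blast
  then have M: "ideal M R" "x \<in> M" "\<nexists>l. colength_le P M l"
    unfolding \<A>_def by auto
  have bounded: "\<exists>l. colength_le P A l" if "ideal A R" "M \<subseteq> A" "A \<noteq> M" for A
    using that max[of A] M(2) unfolding \<A>_def by blast
  have "primeideal M R"
  proof (rule primeidealI[OF M(1) cring_axioms])
    show "carrier R \<noteq> M"
      using M(3) colength_le_carrier[OF P] by blast
    fix u v assume uv: "u \<in> carrier R" "v \<in> carrier R" "u \<otimes> v \<in> M"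
    show "u \<in> M \<or> v \<in> M"
    proof (rule ccontr)
      assume notin: "\<not> ?thesis"
      have "\<exists>k. colength_le P (adjoin M u) k"
        using notin subset_adjoin[OF M(1) uv(1)] by (intro bounded ideal_adjoin M(1) uv(1)) auto
      moreover have "\<exists>l. colength_le P (colon M u) l"
      proof (intro bounded ideal_colon M(1) uv(1))
        show "M \<subseteq> colon M u"
          using ideal.I_l_closed[OF M(1) _ uv(1)] ideal.Icarr[OF M(1)] unfolding colon_def by blast
        show "colon M u \<noteq> M"
          using notin uv unfolding colon_def by blast
      qed
      ultimately show False
        using M(3) colength_le_add[OF P M(1) uv(1)] by blast
    qed
  qed
  then show False
    using M(3) colength_le_prime[OF P M(1)] min M(2) by blast
qed

text \<open>
  Nakayama's lemma at \<open>P\<close>.  Among the localized principal ideals generated by nonzero elements of \<open>J\<close>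
  there is a maximal one, say that of \<open>d\<close>.  Writing \<open>d = x d'\<close> up to a unit at \<open>P\<close>, the element \<open>d'\<close>
  generates a larger ideal, hence the same one, and then \<open>x\<close> would be a unit at \<open>P\<close>.
\<close>

lemma ideal_subset_saturation_mult_imp_zero:
  assumes P: "primeideal P R" and x: "x \<in> P" and J: "ideal J R"
    and sub: "J \<subseteq> saturation P {x \<otimes> r | r. r \<in> J}"
  shows "J \<subseteq> {\<zero>}"
proof (rule ccontr)
  assume "\<not> ?thesis"
  then obtain d0 where d0: "d0 \<in> J" "d0 \<noteq> \<zero>"
    by blast
  have Pi: "ideal P R"
    using P primeideal.axioms(1) by blast
  have xc: "x \<in> carrier R"
    using x ideal.Icarr[OF Pi] by blast
  have Jc: "d \<in> carrier R" if "d \<in> J" for d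
    using that ideal.Icarr[OF J] by blast
  define \<A> where "\<A> = {saturation P (PIdl d) | d. d \<in> J \<and> d \<noteq> \<zero>}"
  have "\<A> \<noteq> {}"
    using d0 unfolding \<A>_def by blast
  moreover have "ideal A R" if "A \<in> \<A>" for A
    using that Jc unfolding \<A>_def by (auto intro!: ideal_saturation[OF P] cgenideal_ideal)
  ultimately obtain M where "M \<in> \<A>" and max: "\<And>A. A \<in> \<A> \<Longrightarrow> M \<subseteq> A \<Longrightarrow> A = M"
    using maximal_ideal_in_family[of \<A>] by blast
  then obtain d where d: "d \<in> J" "d \<noteq> \<zero>" "M = saturation P (PIdl d)"
    unfolding \<A>_def by blast
  obtain s d' where s: "s \<in> carrier R - P" "d' \<in> J" "s \<otimes> d = x \<otimes> d'"
    using sub d(1) unfolding saturation_def by blast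
  have s0: "s \<noteq> \<zero>"
    using s(1) ideal_zero_closed[OF Pi] by blast
  then have "d' \<noteq> \<zero>"
    using s d Jc[OF d(1)] xc integral_iff[of s d] by auto
  moreover have "saturation P (PIdl d) \<subseteq> saturation P (PIdl d')"
  proof -
    have "d \<in> saturation P (PIdl d')"
      unfolding saturation_def using s Jc d(1) xc by (auto simp: cgenideal_def)
    then have "PIdl d \<subseteq> saturation P (PIdl d')"
      by (intro cgenideal_minimal ideal_saturation[OF P] cgenideal_ideal Jc s(2))
    then show ?thesis
      using saturation_mono saturation_saturation[OF P] by blast
  qed
  ultimately have "saturation P (PIdl d') = saturation P (PIdl d)"
    using max[of "saturation P (PIdl d')"] s(2) d(3) unfolding \<A>_def by blast
  moreover have "d' \<in> saturation P (PIdl d')"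
    using subset_saturation[OF P, of "PIdl d'"] cgenideal_self[OF Jc[OF s(2)]]
      ideal.Icarr[OF cgenideal_ideal[OF Jc[OF s(2)]]] by blast
  ultimately have "d' \<in> saturation P (PIdl d)"
    by simp
  then obtain t r where t: "t \<in> carrier R - P" "r \<in> carrier R" "t \<otimes> d' = r \<otimes> d"
    unfolding saturation_def cgenideal_def by blast
  have c: "d \<in> carrier R" "d' \<in> carrier R" "s \<in> carrier R" "t \<in> carrier R"
    using Jc d s t by auto
  have "(t \<otimes> s) \<otimes> d = x \<otimes> (t \<otimes> d')"
    using c xc s(3) by (simp add: m_assoc m_lcomm)
  also have "\<dots> = (x \<otimes> r) \<otimes> d"
    using c xc t by (simp add: m_assoc)
  finally have "t \<otimes> s = x \<otimes> r"
    using c xc t(2) d(2) by (simp add: m_rcancel)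
  moreover have "x \<otimes> r \<in> P"
    using ideal.I_r_closed[OF Pi x t(2)] .
  ultimately show False
    using prime_complement_mult[OF P t(1) s(1)] by simp
qed

end

section \<open>Roots in the fraction field\<close>

text \<open>
  The fraction \<open>y = a/b\<close> is an \<open>N\<close>-th root of \<open>x\<close>.
\<close>

locale fraction_root = noetherian_domain R for R (structure) +
  fixes a b x :: 'a and N :: nat
  assumes a_closed [simp]: "a \<in> carrier R" and b_closed [simp]: "b \<in> carrier R"
    and x_closed [simp]: "x \<in> carrier R" and x_nonzero: "x \<noteq> \<zero>"
    and b_nonzero: "b \<noteq> \<zero>" and N_pos: "0 < N" and root: "a [^] N = x \<otimes> b [^] N"
begin

lemma b_pow_nonzero: "b [^] (i::nat) \<noteq> \<zero>"
  by (induction i) (use b_nonzero integral_iff in auto)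

lemma a_pow_nonzero: "a [^] (i::nat) \<noteq> \<zero>"
proof -
  have "a \<noteq> \<zero>"
    using root N_pos x_nonzero b_pow_nonzero[of N] integral_iff[of x "b [^] N"]
    by (auto simp: nat_pow_zero)
  then show ?thesis
    by (induction i) (use integral_iff in auto)
qed

text \<open>
  The ideal \<open>{r \<in> R. r R[y] \<subseteq> R}\<close>, with denominators cleared.
\<close>

definition conductor :: "'a set" where
  "conductor = {r \<in> carrier R. \<forall>j::nat. \<exists>c\<in>carrier R. r \<otimes> a [^] j = b [^] j \<otimes> c}"

text \<open>
  The ideal \<open>y\<^sup>i J\<close>, where \<open>J\<close> is the conductor.
\<close>

definition twist :: "nat \<Rightarrow> 'a set" where
  "twist i = {r \<in> carrier R. \<exists>r'\<in>conductor. b [^] i \<otimes> r = a [^] i \<otimes> r'}"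

lemma conductor_closed: "r \<in> conductor \<Longrightarrow> r \<in> carrier R"
  by (simp add: conductor_def)

lemma ideal_conductor: "ideal conductor R"
proof (rule cring_idealI)
  show "\<zero> \<in> conductor"
    by (auto simp: conductor_def intro!: bexI[of _ \<zero>])
next
  fix r s assume r: "r \<in> conductor" and s: "s \<in> conductor"
  have "\<exists>c\<in>carrier R. (r \<oplus> s) \<otimes> a [^] j = b [^] j \<otimes> c" for j :: nat
  proof -
    obtain c d where "c \<in> carrier R" "d \<in> carrier R" "r \<otimes> a [^] j = b [^] j \<otimes> c"
      "s \<otimes> a [^] j = b [^] j \<otimes> d"
      using r s unfolding conductor_def by blast
    then show ?thesis
      using r s by (intro bexI[of _ "c \<oplus> d"]) (auto simp: conductor_closed l_distr r_distr)
  qed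
  then show "r \<oplus> s \<in> conductor"
    using r s by (simp add: conductor_def)
next
  fix t r assume t: "t \<in> carrier R" and r: "r \<in> conductor"
  have "\<exists>c\<in>carrier R. (t \<otimes> r) \<otimes> a [^] j = b [^] j \<otimes> c" for j :: nat
  proof -
    obtain c where "c \<in> carrier R" "r \<otimes> a [^] j = b [^] j \<otimes> c"
      using r unfolding conductor_def by blast
    then show ?thesis
      using t r by (intro bexI[of _ "t \<otimes> c"]) (auto simp: conductor_closed m_assoc m_lcomm)
  qed
  then show "t \<otimes> r \<in> conductor"
    using r t by (simp add: conductor_def)
qed (auto simp: conductor_def)

lemma conductor_mult_root:
  assumes r: "r \<in> conductor"
  obtains r' where "r' \<in> conductor" "a \<otimes> r = b \<otimes> r'"
proof -
  have rc: "r \<in> carrier R"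
    using r conductor_closed by blast
  obtain r' where r': "r' \<in> carrier R" "r \<otimes> a [^] (1::nat) = b [^] (1::nat) \<otimes> r'"
    using r unfolding conductor_def by blast
  then have e: "a \<otimes> r = b \<otimes> r'"
    using rc by (simp add: m_comm)
  have "\<exists>c\<in>carrier R. r' \<otimes> a [^] j = b [^] j \<otimes> c" for j :: nat
  proof -
    obtain c where c: "c \<in> carrier R" "r \<otimes> a [^] Suc j = b [^] Suc j \<otimes> c"
      using r unfolding conductor_def by blast
    have "b \<otimes> (r' \<otimes> a [^] j) = (a \<otimes> r) \<otimes> a [^] j"
      using r' rc by (simp add: e m_assoc)
    also have "\<dots> = r \<otimes> a [^] Suc j"
      using rc by (simp add: m_ac)
    also have "\<dots> = b \<otimes> (b [^] j \<otimes> c)"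
      unfolding c(2) using c(1) by (simp add: m_ac)
    finally have "r' \<otimes> a [^] j = b [^] j \<otimes> c"
      using r' c b_nonzero by (simp add: m_lcancel)
    then show ?thesis
      using c(1) by blast
  qed
  then have "r' \<in> conductor"
    using r' by (simp add: conductor_def)
  then show thesis
    using that e by blast
qed

lemma conductor_mult_root_pow:
  assumes r: "r \<in> conductor"
  obtains r' where "r' \<in> conductor" "a [^] (i::nat) \<otimes> r = b [^] i \<otimes> r'"
proof -
  have "\<exists>r'\<in>conductor. a [^] i \<otimes> r = b [^] i \<otimes> r'"
  proof (induction i)
    case 0
    show ?case
      using r conductor_closed by auto
  next
    case (Suc i)
    then obtain s where s: "s \<in> conductor" "a [^] i \<otimes> r = b [^] i \<otimes> s"
      by blast
    obtain t where t: "t \<in> conductor" "a \<otimes> s = b \<otimes> t"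
      using conductor_mult_root[OF s(1)] .
    have c: "r \<in> carrier R" "s \<in> carrier R" "t \<in> carrier R"
      using r s t conductor_closed by auto
    have "a [^] Suc i \<otimes> r = a \<otimes> (a [^] i \<otimes> r)"
      using c by (simp add: m_ac)
    also have "\<dots> = b [^] i \<otimes> (a \<otimes> s)"
      unfolding s(2) using c by (simp add: m_lcomm)
    also have "\<dots> = b [^] Suc i \<otimes> t"
      unfolding t(2) using c by (simp add: m_ac)
    finally show ?case
      using t(1) by blast
  qed
  then show thesis
    using that by blast
qed

lemma root_pow: "a [^] (k * N) = x [^] k \<otimes> b [^] (k * N)"
proof -
  have "a [^] (k * N) = (a [^] N) [^] k"
    by (simp add: nat_pow_pow mult.commute)
  also have "\<dots> = x [^] k \<otimes> b [^] (k * N)"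
    unfolding root by (simp add: nat_pow_distrib nat_pow_pow mult.commute)
  finally show ?thesis .
qed

text \<open>
  Because \<open>y\<^sup>N = x \<in> R\<close>, the ring \<open>R[y]\<close> is generated over \<open>R\<close> by the powers of \<open>y\<close> with exponent less
  than \<open>N\<close>, and \<open>b\<^sup>N\<^sup>-\<^sup>1\<close> is a common denominator for these.
\<close>

lemma b_pow_in_conductor: "b [^] (N - 1) \<in> conductor"
proof -
  have "\<exists>c\<in>carrier R. b [^] (N - 1) \<otimes> a [^] j = b [^] j \<otimes> c" for j :: nat
  proof -
    define q t where "q = j div N" and "t = j mod N"
    have j: "j = q * N + t" and t: "t \<le> N - 1"
      unfolding q_def t_def using N_pos mod_less_divisor[of N j] by (auto simp del: mod_less_divisor)
    define u where "u = N - 1 - t"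
    have N1: "N - 1 = t + u"
      unfolding u_def using t by simp
    have "b [^] (N - 1) \<otimes> a [^] j = (b [^] t \<otimes> b [^] u) \<otimes> (a [^] (q * N) \<otimes> a [^] t)"
      unfolding j N1 by (simp add: nat_pow_mult)
    also have "\<dots> = (b [^] (q * N) \<otimes> b [^] t) \<otimes> (x [^] q \<otimes> (a [^] t \<otimes> b [^] u))"
      unfolding root_pow by (simp add: m_ac)
    also have "\<dots> = b [^] j \<otimes> (x [^] q \<otimes> (a [^] t \<otimes> b [^] u))"
      unfolding j by (simp add: nat_pow_mult)
    finally show ?thesis
      by (rule bexI) simp
  qed
  then show ?thesis
    by (simp add: conductor_def)
qed

lemma ideal_twist: "ideal (twist i) R"
proof (rule cring_idealI)
  show "\<zero> \<in> twist i"
    using ideal_zero_closed[OF ideal_conductor] by (auto simp: twist_def intro!: bexI[of _ \<zero>])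
next
  fix r s assume "r \<in> twist i" "s \<in> twist i"
  then obtain r' s' where rs: "r \<in> carrier R" "s \<in> carrier R" "r' \<in> conductor" "s' \<in> conductor"
    "b [^] i \<otimes> r = a [^] i \<otimes> r'" "b [^] i \<otimes> s = a [^] i \<otimes> s'"
    unfolding twist_def by blast
  then have "b [^] i \<otimes> (r \<oplus> s) = a [^] i \<otimes> (r' \<oplus> s')"
    by (simp add: r_distr conductor_closed)
  then show "r \<oplus> s \<in> twist i"
    using rs ideal_add_closed[OF ideal_conductor] unfolding twist_def by blast
next
  fix t r assume t: "t \<in> carrier R" and "r \<in> twist i"
  then obtain r' where r: "r \<in> carrier R" "r' \<in> conductor" "b [^] i \<otimes> r = a [^] i \<otimes> r'"
    unfolding twist_def by blast
  then have "b [^] i \<otimes> (t \<otimes> r) = a [^] i \<otimes> (t \<otimes> r')"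
    using t conductor_closed[OF r(2)] by (simp add: m_lcomm)
  then show "t \<otimes> r \<in> twist i"
    using r t ideal.I_l_closed[OF ideal_conductor] unfolding twist_def by blast
qed (auto simp: twist_def)

lemma twist_0: "twist 0 = conductor"
  unfolding twist_def using conductor_closed by auto

lemma twist_decreasing: "twist (Suc i) \<subseteq> twist i"
proof
  fix r assume "r \<in> twist (Suc i)"
  then obtain r' where r: "r \<in> carrier R" "r' \<in> conductor" "b [^] Suc i \<otimes> r = a [^] Suc i \<otimes> r'"
    unfolding twist_def by blast
  obtain s where s: "s \<in> conductor" "a \<otimes> r' = b \<otimes> s"
    using conductor_mult_root[OF r(2)] .
  have c: "r' \<in> carrier R" "s \<in> carrier R"
    using r s conductor_closed by auto
  have "b \<otimes> (b [^] i \<otimes> r) = b [^] Suc i \<otimes> r"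
    using r(1) by (simp add: m_ac)
  also have "\<dots> = a [^] i \<otimes> (a \<otimes> r')"
    unfolding r(3) using c by (simp add: m_assoc)
  also have "\<dots> = b \<otimes> (a [^] i \<otimes> s)"
    unfolding s(2) using c by (simp add: m_lcomm)
  finally have "b [^] i \<otimes> r = a [^] i \<otimes> s"
    using r(1) c b_nonzero by (simp add: m_lcancel)
  then show "r \<in> twist i"
    unfolding twist_def using r(1) s(1) by blast
qed

lemma twist_antimono: "i \<le> j \<Longrightarrow> twist j \<subseteq> twist i"
  using lift_Suc_antimono_le[of twist, OF twist_decreasing] .

lemma twist_mult_N: "twist (k * N) = {x [^] k \<otimes> r | r. r \<in> conductor}"
proof -
  have "b [^] (k * N) \<otimes> r = a [^] (k * N) \<otimes> r' \<longleftrightarrow> r = x [^] k \<otimes> r'"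
    if "r \<in> carrier R" "r' \<in> carrier R" for r r'
  proof -
    have "a [^] (k * N) \<otimes> r' = b [^] (k * N) \<otimes> (x [^] k \<otimes> r')"
      unfolding root_pow using that by (simp add: m_ac)
    then show ?thesis
      using that b_pow_nonzero by (simp add: m_lcancel)
  qed
  then show ?thesis
    unfolding twist_def using conductor_closed by fastforce
qed

text \<open>
  Multiplication by a power of \<open>y\<close> carries any step of the chain \<open>J \<supseteq> yJ \<supseteq> y\<^sup>2J \<supseteq> \<dots>\<close> to any other,
  so an equality at \<open>P\<close> in one step gives equality in all steps.
\<close>

lemma twist_subset_saturation:
  assumes P: "primeideal P R" and sub: "twist i \<subseteq> saturation P (twist (Suc i))"
  shows "twist k \<subseteq> saturation P (twist (Suc k))"
proof -
  \<comment> \<open>The first step of the chain, to which the given step is moved back.\<close>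
  have base: "\<exists>s\<in>carrier R - P. \<exists>r'\<in>conductor. b \<otimes> (s \<otimes> r) = a \<otimes> r'" if r: "r \<in> conductor" for r
  proof -
    have rc: "r \<in> carrier R"
      using r conductor_closed by blast
    obtain u where u: "u \<in> conductor" "a [^] i \<otimes> r = b [^] i \<otimes> u"
      using conductor_mult_root_pow[OF r] .
    have uc: "u \<in> carrier R"
      using u conductor_closed by blast
    have "u \<in> twist i"
      unfolding twist_def using u r uc by force
    then obtain s r' where s: "s \<in> carrier R - P" "r' \<in> conductor"
      "b [^] Suc i \<otimes> (s \<otimes> u) = a [^] Suc i \<otimes> r'"
      using sub unfolding saturation_def twist_def by blast
    have c: "r' \<in> carrier R" "s \<in> carrier R"
      using s conductor_closed by auto
    have "a [^] i \<otimes> (b \<otimes> (s \<otimes> r)) = b \<otimes> (s \<otimes> (a [^] i \<otimes> r))"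
      using c rc by (simp add: m_ac)
    also have "\<dots> = b [^] Suc i \<otimes> (s \<otimes> u)"
      unfolding u(2) using c uc by (simp add: m_ac)
    also have "\<dots> = a [^] i \<otimes> (a \<otimes> r')"
      unfolding s(3) using c by (simp add: m_assoc)
    finally have "a [^] i \<otimes> (b \<otimes> (s \<otimes> r)) = a [^] i \<otimes> (a \<otimes> r')" .
    then have "b \<otimes> (s \<otimes> r) = a \<otimes> r'"
      using c rc a_pow_nonzero by (simp add: m_lcancel)
    then show ?thesis
      using s by blast
  qed
  show ?thesis
  proof
    fix w assume "w \<in> twist k"
    then obtain r where r: "w \<in> carrier R" "r \<in> conductor" "b [^] k \<otimes> w = a [^] k \<otimes> r"
      unfolding twist_def by blast
    obtain s r' where s: "s \<in> carrier R - P" "r' \<in> conductor" "b \<otimes> (s \<otimes> r) = a \<otimes> r'"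
      using base[OF r(2)] by blast
    have c: "r' \<in> carrier R" "s \<in> carrier R" "r \<in> carrier R"
      using r s conductor_closed by auto
    have "b [^] Suc k \<otimes> (s \<otimes> w) = b \<otimes> (s \<otimes> (b [^] k \<otimes> w))"
      using c r(1) by (simp add: m_ac)
    also have "\<dots> = a [^] k \<otimes> (b \<otimes> (s \<otimes> r))"
      unfolding r(3) using c by (simp add: m_ac)
    also have "\<dots> = a [^] Suc k \<otimes> r'"
      unfolding s(3) using c by (simp add: m_assoc)
    finally have "s \<otimes> w \<in> twist (Suc k)"
      unfolding twist_def using c r(1) s(2) by blast
    then show "w \<in> saturation P (twist (Suc k))"
      unfolding saturation_def using s(1) r(1) by blast
  qed
qed

text \<open>
  If one step were an equality at \<open>P\<close>, all would be, and \<open>N\<close> steps lead from \<open>J\<close> to \<open>xJ\<close>.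
\<close>

lemma twist_not_subset_saturation:
  assumes P: "primeideal P R" and x: "x \<in> P"
  shows "\<not> twist i \<subseteq> saturation P (twist (Suc i))"
proof
  assume sub: "twist i \<subseteq> saturation P (twist (Suc i))"
  have "twist 0 \<subseteq> saturation P (twist k)" for k
  proof (induction k)
    case 0
    show ?case
      using ideal.Icarr[OF ideal_twist] by (intro subset_saturation[OF P]) blast
  next
    case (Suc k)
    also have "saturation P (twist k) \<subseteq> saturation P (saturation P (twist (Suc k)))"
      by (intro saturation_mono twist_subset_saturation[OF P sub])
    also have "\<dots> \<subseteq> saturation P (twist (Suc k))"
      by (rule saturation_saturation[OF P])
    finally show ?case .
  qed
  from this[of "1 * N"] have "conductor \<subseteq> saturation P {x \<otimes> r | r. r \<in> conductor}"
    unfolding twist_0 twist_mult_N by simp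
  then have "conductor \<subseteq> {\<zero>}"
    by (rule ideal_subset_saturation_mult_imp_zero[OF P x ideal_conductor])
  then show False
    using b_pow_in_conductor b_pow_nonzero by blast
qed

text \<open>
  A multiplicity argument.  By the choice of \<open>c\<close> below, \<open>J \<inter> x\<^sup>k\<^sup>+\<^sup>cR \<subseteq> x\<^sup>kJ\<close>, an elementary
  instance of the Artin-Rees lemma.  Therefore the chain from \<open>J\<close> down to \<open>x\<^sup>kJ\<close>, which has \<open>kN\<close> strict
  steps at \<open>P\<close>, stays strict after adding \<open>x\<^sup>k\<^sup>+\<^sup>cR\<close>, an ideal of colength at most \<open>(k + c) l\<close>.  The
  constant \<open>c\<close> does not depend on \<open>k\<close>, so its contribution is negligible for large \<open>k\<close>.
\<close>

lemma root_degree_le: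
  assumes P: "primeideal P R" and x: "x \<in> P" and l: "colength_le P (PIdl x) l"
  shows "N \<le> l"
proof -
  define \<A> where "\<A> = range (\<lambda>k::nat. colon conductor (x [^] k))"
  have "\<A> \<noteq> {}"
    unfolding \<A>_def by blast
  moreover have "ideal A R" if "A \<in> \<A>" for A
    using that unfolding \<A>_def by (auto intro!: ideal_colon ideal_conductor)
  ultimately obtain M where M: "M \<in> \<A>" and max: "\<And>A. A \<in> \<A> \<Longrightarrow> M \<subseteq> A \<Longrightarrow> A = M"
    using maximal_ideal_in_family[of \<A>] by blast
  obtain c :: nat where c: "M = colon conductor (x [^] c)"
    using M unfolding \<A>_def by blast
  have stable: "colon conductor (x [^] (k + c)) = M" for k
  proof (rule max)
    show "colon conductor (x [^] (k + c)) \<in> \<A>"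
      unfolding \<A>_def by blast
    have "x [^] (k + c) \<otimes> r = x [^] k \<otimes> (x [^] c \<otimes> r)" if "r \<in> carrier R" for r
      using that by (simp add: nat_pow_mult m_assoc[symmetric])
    then show "M \<subseteq> colon conductor (x [^] (k + c))"
      unfolding c colon_def by (auto simp: ideal.I_l_closed[OF ideal_conductor])
  qed
  have bound: "k * N \<le> (k + c) * l" for k
  proof -
    define L where "L i = adjoin (twist i) (x [^] (k + c))" for i
    have idL: "ideal (L i) R" for i
      unfolding L_def by (intro ideal_adjoin ideal_twist) simp
    have jump: "\<not> L i \<subseteq> saturation P (L (Suc i))" if i: "i < k * N" for i
    proof
      assume sub: "L i \<subseteq> saturation P (L (Suc i))"
      have "twist i \<subseteq> saturation P (twist (Suc i))"
      proof
        fix r assume r: "r \<in> twist i"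
        then have "r \<in> saturation P (L (Suc i))"
          using sub subset_adjoin(1)[OF ideal_twist, of "x [^] (k + c)" i] unfolding L_def by auto
        then obtain s w u where s: "r \<in> carrier R" "s \<in> carrier R - P" "w \<in> twist (Suc i)"
          "u \<in> carrier R" "s \<otimes> r = w \<oplus> x [^] (k + c) \<otimes> u"
          unfolding saturation_def L_def adjoin_def by blast
        have wc: "w \<in> carrier R"
          using s(3) ideal.Icarr[OF ideal_twist] by blast
        have "s \<otimes> r \<ominus> w \<in> twist i"
        proof (rule ideal_diff_closed[OF ideal_twist])
          show "s \<otimes> r \<in> twist i"
            using s(2) r by (simp add: ideal.I_l_closed[OF ideal_twist])
          show "w \<in> twist i"
            using s(3) twist_decreasing by blast
        qed
        moreover have "s \<otimes> r \<ominus> w = x [^] (k + c) \<otimes> u"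
          unfolding s(5) using wc s(4) by (intro add_diff_cancel) auto
        moreover have "twist i \<subseteq> conductor"
          using twist_antimono[of 0 i] twist_0 by simp
        ultimately have "x [^] (k + c) \<otimes> u \<in> conductor"
          by (metis subsetD)
        then have "u \<in> colon conductor (x [^] (k + c))"
          using s(4) unfolding colon_def by blast
        then have "u \<in> colon conductor (x [^] c)"
          by (simp only: stable c)
        then have "x [^] c \<otimes> u \<in> conductor"
          unfolding colon_def by blast
        moreover have "x [^] (k + c) \<otimes> u = x [^] k \<otimes> (x [^] c \<otimes> u)"
          using s(4) by (simp add: nat_pow_mult m_assoc[symmetric])
        ultimately have "x [^] (k + c) \<otimes> u \<in> twist (k * N)"
          unfolding twist_mult_N by blast
        then have "x [^] (k + c) \<otimes> u \<in> twist (Suc i)"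
          using twist_antimono[of "Suc i" "k * N"] i by auto
        then have "s \<otimes> r \<in> twist (Suc i)"
          unfolding s(5) by (intro ideal_add_closed[OF ideal_twist] s(3))
        then show "r \<in> saturation P (twist (Suc i))"
          unfolding saturation_def using s by blast
      qed
      then show False
        using twist_not_subset_saturation[OF P x] by blast
    qed
    have "k * N = card {i. i < k * N \<and> \<not> L i \<subseteq> saturation P (L (Suc i))}"
    proof -
      have "{i. i < k * N \<and> \<not> L i \<subseteq> saturation P (L (Suc i))} = {..<k * N}"
        using jump by blast
      then show ?thesis
        by simp
    qed
    also have "\<dots> \<le> (k + c) * l"
    proof (rule colength_leD[OF colength_le_powers[OF P x_closed l]])
      show "ideal (L i) R" for i
        by (rule idL)
      show "PIdl (x [^] (k + c)) \<subseteq> L i" for i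
        using idL subset_adjoin(2)[OF ideal_twist] unfolding L_def by (intro cgenideal_minimal) auto
      show "L (Suc i) \<subseteq> L i" for i
        using twist_decreasing[of i] unfolding L_def adjoin_def by blast
    qed
    finally show ?thesis .
  qed
  show ?thesis
  proof (rule ccontr)
    assume "\<not> N \<le> l"
    \<comment> \<open>If \<open>N \<ge> l + 1\<close>, the bound gives \<open>k \<le> c l\<close>, so \<open>k = c l + 1\<close> contradicts it.\<close>
    then have "(c * l + 1) * (l + 1) \<le> (c * l + 1) * N"
      by (intro mult_left_mono) auto
    also have "\<dots> \<le> (c * l + 1 + c) * l"
      by (rule bound)
    finally show False
      by (simp add: algebra_simps)
  qed
qed

end

context cring
begin

text \<open>
  The element \<open>b\<close> is a square in the fraction field.
\<close>

definition square_of_fraction :: "'a \<Rightarrow> bool" where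
  "square_of_fraction b \<longleftrightarrow>
     (\<exists>r\<in>carrier R. \<exists>s\<in>carrier R. s \<noteq> \<zero> \<and> r \<otimes> r = b \<otimes> (s \<otimes> s))"

end

context domain
begin

lemma square_of_fraction_mult_square:
  assumes "b \<in> carrier R" "c \<in> carrier R" "c \<noteq> \<zero>" "square_of_fraction (b \<otimes> (c \<otimes> c))"
  shows "square_of_fraction b"
proof -
  obtain r s where rs: "r \<in> carrier R" "s \<in> carrier R" "s \<noteq> \<zero>"
    "r \<otimes> r = b \<otimes> (c \<otimes> c) \<otimes> (s \<otimes> s)"
    using assms(4) unfolding square_of_fraction_def by blast
  then have "r \<otimes> r = b \<otimes> ((c \<otimes> s) \<otimes> (c \<otimes> s))" "c \<otimes> s \<noteq> \<zero>"
    using assms integral_iff[of c s] by (simp_all add: m_ac)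
  then show ?thesis
    unfolding square_of_fraction_def using rs assms by blast
qed

text \<open>
  If all elements of \<open>R\<close> are squares in the fraction field, then so are numerator and denominator of a
  \<open>2\<^sup>n\<close>-th root of \<open>x\<close>; this provides a square root of that root.
\<close>

lemma root_of_fraction_exists:
  assumes sq: "\<And>b. b \<in> carrier R \<Longrightarrow> square_of_fraction b"
    and x: "x \<in> carrier R" "x \<noteq> \<zero>"
  shows "\<exists>a\<in>carrier R. \<exists>b\<in>carrier R. b \<noteq> \<zero> \<and> a [^] ((2::nat) ^ n) = x \<otimes> b [^] ((2::nat) ^ n)"
proof (induction n)
  case 0
  show ?case
    using x by (intro bexI[of _ x] bexI[of _ \<one>]) auto
next
  case (Suc n)
  define N where "N = (2::nat) ^ n"
  obtain a b where ab: "a \<in> carrier R" "b \<in> carrier R" "b \<noteq> \<zero>" "a [^] N = x \<otimes> b [^] N"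
    using Suc unfolding N_def by blast
  obtain r s where rs: "r \<in> carrier R" "s \<in> carrier R" "s \<noteq> \<zero>" "r \<otimes> r = a \<otimes> (s \<otimes> s)"
    using sq[OF ab(1)] unfolding square_of_fraction_def by blast
  obtain u v where uv: "u \<in> carrier R" "v \<in> carrier R" "v \<noteq> \<zero>" "u \<otimes> u = b \<otimes> (v \<otimes> v)"
    using sq[OF ab(2)] unfolding square_of_fraction_def by blast
  have "u \<otimes> u \<noteq> \<zero>"
    unfolding uv(4) using ab(2,3) uv(2,3) by (simp add: integral_iff)
  then have "u \<noteq> \<zero>"
    by auto
  then have su: "s \<otimes> u \<noteq> \<zero>"
    using rs(2,3) uv(1) integral_iff[of s u] by simp
  have sqpow: "y [^] (2 * N) = (y \<otimes> y) [^] N" if "y \<in> carrier R" for y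
    using that by (simp add: nat_pow_distrib nat_pow_mult mult_2)
  have c: "a [^] N \<in> carrier R" "b [^] N \<in> carrier R" "(s \<otimes> s) [^] N \<in> carrier R"
    "(v \<otimes> v) [^] N \<in> carrier R"
    using ab(1,2) rs(1,2) uv(1,2) by simp_all
  have "(r \<otimes> v) [^] (2 * N) = (r \<otimes> r \<otimes> (v \<otimes> v)) [^] N"
    using rs(1,2) uv(1,2) by (simp add: sqpow m_ac)
  also have "\<dots> = a [^] N \<otimes> (s \<otimes> s) [^] N \<otimes> (v \<otimes> v) [^] N"
    unfolding rs(4) using ab(1,2) rs(1,2) uv(1,2) by (simp add: nat_pow_distrib)
  also have "\<dots> = x \<otimes> ((s \<otimes> s) [^] N \<otimes> (b [^] N \<otimes> (v \<otimes> v) [^] N))"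
    unfolding ab(4) using c x by (simp add: m_ac)
  also have "\<dots> = x \<otimes> (s \<otimes> s \<otimes> (u \<otimes> u)) [^] N"
    unfolding uv(4) using ab(1,2) rs(1,2) uv(1,2) by (simp add: nat_pow_distrib)
  also have "\<dots> = x \<otimes> (s \<otimes> u) [^] (2 * N)"
    using rs(1,2) uv(1,2) by (simp add: sqpow m_ac)
  finally have "(r \<otimes> v) [^] ((2::nat) ^ Suc n) = x \<otimes> (s \<otimes> u) [^] ((2::nat) ^ Suc n)"
    unfolding N_def by simp
  then show ?case
    using su m_closed rs(1,2) uv(1,2) by blast
qed

end

context noetherian_domain
begin

lemma exists_nonsquare:
  assumes P0: "primeideal P0 R" and x: "x \<in> P0" "x \<noteq> \<zero>"
  shows "\<exists>b\<in>carrier R. \<not> square_of_fraction b"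
proof (rule ccontr)
  assume "\<not> ?thesis"
  then have sq: "square_of_fraction b" if "b \<in> carrier R" for b
    using that by blast
  have xc: "x \<in> carrier R"
    using x(1) P0 ideal.Icarr primeideal.axioms(1) by metis
  obtain P where P: "primeideal P R" "x \<in> P"
    and min: "\<And>Q. primeideal Q R \<Longrightarrow> x \<in> Q \<Longrightarrow> Q \<subseteq> P \<Longrightarrow> Q = P"
    by (rule minimal_prime_exists[OF P0 x(1)]) blast
  obtain l where l: "colength_le P (PIdl x) l"
    using colength_le_exists[OF P(1) xc min] by blast
  obtain a b where ab: "a \<in> carrier R" "b \<in> carrier R" "b \<noteq> \<zero>"
    "a [^] ((2::nat) ^ l) = x \<otimes> b [^] ((2::nat) ^ l)"
    using root_of_fraction_exists[OF sq xc x(2), of l] by blast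
  interpret fraction_root R a b x "2 ^ l"
    by unfold_locales (use ab xc x in auto)
  have "2 ^ l \<le> l"
    by (rule root_degree_le[OF P l])
  then show False
    using less_exp[of l] by simp
qed

text \<open>
  Multiplying a nonsquare \<open>b\<close> by squares gives nonsquares, and the \<open>b x\<^sup>2\<^sup>n\<close> are distinct because
  \<open>x\<close> is neither zero nor a unit.
\<close>

lemma infinitely_many_nonsquares:
  assumes P0: "primeideal P0 R" and x: "x \<in> P0" "x \<noteq> \<zero>"
  shows "infinite {b \<in> carrier R. \<not> square_of_fraction b}"
proof -
  obtain b where b: "b \<in> carrier R" "\<not> square_of_fraction b"
    using exists_nonsquare[OF assms] by blast
  have P0i: "ideal P0 R"
    using P0 primeideal.axioms(1) by blast
  have xc: "x \<in> carrier R"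
    using x(1) ideal.Icarr[OF P0i] by blast
  have pow: "x [^] (n::nat) \<noteq> \<zero>" for n
    by (induction n) (use x xc integral_iff in auto)
  have b0: "b \<noteq> \<zero>"
  proof
    assume "b = \<zero>"
    then have "\<zero> \<otimes> \<zero> = b \<otimes> (\<one> \<otimes> \<one>)"
      by simp
    then show False
      using b(2) one_not_zero unfolding square_of_fraction_def by blast
  qed
  define f where "f n = b \<otimes> (x [^] n \<otimes> x [^] n)" for n :: nat
  have "f n \<in> {b \<in> carrier R. \<not> square_of_fraction b}" for n
    using square_of_fraction_mult_square[OF b(1) _ pow, of n] b xc unfolding f_def by auto
  moreover have "f m \<noteq> f n" if "m < n" for m n
  proof
    assume "f m = f n"
    then have "x [^] (m + m) = x [^] (n + n)"
      unfolding f_def using b b0 xc by (simp add: m_lcancel nat_pow_mult)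
    moreover have "n + n = (m + m) + Suc (2 * (n - m) - 1)"
      using that by simp
    ultimately have "x [^] (m + m) \<otimes> \<one> = x [^] (m + m) \<otimes> x [^] Suc (2 * (n - m) - 1)"
      using xc by (metis nat_pow_closed nat_pow_mult r_one)
    then have "\<one> = x [^] (2 * (n - m) - 1) \<otimes> x"
      using xc pow by (subst (asm) m_lcancel) auto
    also have "\<dots> \<in> P0"
      using x xc by (intro ideal.I_l_closed[OF P0i]) auto
    finally show False
      using ideal.one_imp_carrier[OF P0i] primeideal.I_notcarr[OF P0] by simp
  qed
  then have "inj f"
    by (metis injI linorder_neqE_nat)
  ultimately show ?thesis
    using infinite_iff_countable_subset by blast
qed

end

section \<open>The quadratic extension\<close>

text \<open>
  The ring \<open>R[t]/(t\<^sup>2 - b)\<close>; the pair \<open>(r, i)\<close> stands for \<open>r + i t\<close>.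
\<close>

definition quadratic_extension :: "('a, 'b) ring_scheme \<Rightarrow> 'a \<Rightarrow> ('a \<times> 'a) ring" where
  "quadratic_extension R b =
     \<lparr>carrier = carrier R \<times> carrier R,
      monoid.mult = (\<lambda>x y. (fst x \<otimes>\<^bsub>R\<^esub> fst y \<oplus>\<^bsub>R\<^esub> b \<otimes>\<^bsub>R\<^esub> (snd x \<otimes>\<^bsub>R\<^esub> snd y),
        fst x \<otimes>\<^bsub>R\<^esub> snd y \<oplus>\<^bsub>R\<^esub> snd x \<otimes>\<^bsub>R\<^esub> fst y)),
      one = (\<one>\<^bsub>R\<^esub>, \<zero>\<^bsub>R\<^esub>),
      zero = (\<zero>\<^bsub>R\<^esub>, \<zero>\<^bsub>R\<^esub>),
      add = (\<lambda>x y. (fst x \<oplus>\<^bsub>R\<^esub> fst y, snd x \<oplus>\<^bsub>R\<^esub> snd y))\<rparr>"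

context cring
begin

lemma quadratic_extension_sel [simp]:
  "carrier (quadratic_extension R b) = carrier R \<times> carrier R"
  "(r, i) \<otimes>\<^bsub>quadratic_extension R b\<^esub> (s, j) = (r \<otimes> s \<oplus> b \<otimes> (i \<otimes> j), r \<otimes> j \<oplus> i \<otimes> s)"
  "\<one>\<^bsub>quadratic_extension R b\<^esub> = (\<one>, \<zero>)"
  "\<zero>\<^bsub>quadratic_extension R b\<^esub> = (\<zero>, \<zero>)"
  "(r, i) \<oplus>\<^bsub>quadratic_extension R b\<^esub> (s, j) = (r \<oplus> s, i \<oplus> j)"
  by (simp_all add: quadratic_extension_def)

lemma cring_quadratic_extension:
  assumes "b \<in> carrier R"
  shows "cring (quadratic_extension R b)" (is "cring ?S")
proof (rule cringI)
  show "abelian_group ?S"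
  proof (rule abelian_groupI)
    show "\<exists>y\<in>carrier ?S. y \<oplus>\<^bsub>?S\<^esub> x = \<zero>\<^bsub>?S\<^esub>" if "x \<in> carrier ?S" for x
      using that by (intro bexI[of _ "(\<ominus> fst x, \<ominus> snd x)"]) (auto simp: l_neg)
  qed (auto simp: a_ac)
  show "comm_monoid ?S"
  proof (rule comm_monoidI)
    show "x \<otimes>\<^bsub>?S\<^esub> y \<otimes>\<^bsub>?S\<^esub> z = x \<otimes>\<^bsub>?S\<^esub> (y \<otimes>\<^bsub>?S\<^esub> z)"
      if "x \<in> carrier ?S" "y \<in> carrier ?S" "z \<in> carrier ?S" for x y z
      using that assms by (cases x; cases y; cases z) (simp add: l_distr r_distr m_ac a_ac)
    show "x \<otimes>\<^bsub>?S\<^esub> y = y \<otimes>\<^bsub>?S\<^esub> x" if "x \<in> carrier ?S" "y \<in> carrier ?S" for x y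
      using that assms by (cases x; cases y) (simp add: m_ac a_ac)
  qed (use assms in auto)
  show "(x \<oplus>\<^bsub>?S\<^esub> y) \<otimes>\<^bsub>?S\<^esub> z = x \<otimes>\<^bsub>?S\<^esub> z \<oplus>\<^bsub>?S\<^esub> y \<otimes>\<^bsub>?S\<^esub> z"
    if "x \<in> carrier ?S" "y \<in> carrier ?S" "z \<in> carrier ?S" for x y z
    using that assms by (cases x; cases y; cases z) (simp add: l_distr r_distr m_ac a_ac)
qed

end

context domain
begin

text \<open>
  Suppose that \<open>(r + i t) (s + j t) = 0\<close>.  Multiplying by the conjugate \<open>r - i t\<close> and comparing the
  coefficients of \<open>t\<close> yields \<open>(r\<^sup>2 - b i\<^sup>2) j = 0\<close>, and the norm \<open>r\<^sup>2 - b i\<^sup>2\<close> can only vanish together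
  with \<open>r\<close> and \<open>i\<close>, as \<open>b\<close> is not the square of \<open>r/i\<close>.
\<close>

lemma domain_quadratic_extension:
  assumes b: "b \<in> carrier R" "\<not> square_of_fraction b"
  shows "domain (quadratic_extension R b)" (is "domain ?S")
proof (intro domain.intro domain_axioms.intro)
  show "cring ?S"
    by (rule cring_quadratic_extension[OF b(1)])
  show "\<one>\<^bsub>?S\<^esub> \<noteq> \<zero>\<^bsub>?S\<^esub>"
    by simp
  fix x y assume xy: "x \<otimes>\<^bsub>?S\<^esub> y = \<zero>\<^bsub>?S\<^esub>" "x \<in> carrier ?S" "y \<in> carrier ?S"
  obtain r i s j where xy_def: "x = (r, i)" "y = (s, j)"
    by (cases x; cases y)
  have c: "r \<in> carrier R" "i \<in> carrier R" "s \<in> carrier R" "j \<in> carrier R"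
    using xy(2,3) unfolding xy_def by auto
  have e: "r \<otimes> s \<oplus> b \<otimes> (i \<otimes> j) = \<zero>" "r \<otimes> j \<oplus> i \<otimes> s = \<zero>"
    using xy(1) unfolding xy_def by auto
  have "(r \<otimes> r \<ominus> b \<otimes> (i \<otimes> i)) \<otimes> j
      = r \<otimes> (r \<otimes> j \<oplus> i \<otimes> s) \<ominus> i \<otimes> (r \<otimes> s \<oplus> b \<otimes> (i \<otimes> j))"
    using c b(1) by algebra
  also have "\<dots> = \<zero>"
    unfolding e using c by (simp add: a_minus_def)
  finally have "r \<otimes> r \<ominus> b \<otimes> (i \<otimes> i) = \<zero> \<or> j = \<zero>"
    using c b(1) by (simp add: integral_iff)
  then have "x = \<zero>\<^bsub>?S\<^esub> \<or> j = \<zero>"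
  proof
    assume "r \<otimes> r \<ominus> b \<otimes> (i \<otimes> i) = \<zero>"
    then have *: "r \<otimes> r = b \<otimes> (i \<otimes> i)"
      using c b(1) by simp
    then have "i = \<zero>"
      using b(2) c unfolding square_of_fraction_def by blast
    then show ?thesis
      using * c b(1) unfolding xy_def by (simp add: integral_iff)
  qed simp
  moreover have "x = \<zero>\<^bsub>?S\<^esub> \<or> y = \<zero>\<^bsub>?S\<^esub>" if "j = \<zero>"
    using e c b(1) that unfolding xy_def by (auto simp: integral_iff)
  ultimately show "x = \<zero>\<^bsub>?S\<^esub> \<or> y = \<zero>\<^bsub>?S\<^esub>"
    by blast
qed

end

section \<open>Polynomials modulo a monic quadratic polynomial\<close>

text \<open>
  Evaluation at the square root \<open>(0, 1)\<close> of \<open>b\<close> kills \<open>t\<^sup>2 - b\<close>.  Conversely, division by this monic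
  polynomial leaves a remainder \<open>r\<^sub>0 + r\<^sub>1 t\<close>, whose value \<open>(r\<^sub>0, r\<^sub>1)\<close> determines it.
\<close>

lemma (in domain) quadratic_evaluation:
  assumes b: "b \<in> carrier R"
  obtains E where "E \<in> ring_hom (UP R) (quadratic_extension R b)"
    "\<And>p. p \<in> carrier (UP R) \<Longrightarrow>
      E p = \<zero>\<^bsub>quadratic_extension R b\<^esub> \<longleftrightarrow> p \<in> PIdl\<^bsub>UP R\<^esub> (monic_quadratic R \<zero> (\<ominus> b))"
proof -
  define S where "S = quadratic_extension R b"
  define P where "P = UP R"
  interpret S: cring S
    unfolding S_def by (rule cring_quadratic_extension[OF b])
  define h where "h r = (r, \<zero>)" for r :: 'a
  have h: "h \<in> ring_hom R S"
    using b by (intro ring_hom_memI) (auto simp: S_def h_def)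
  interpret UP_pre_univ_prop R S h P
    by (intro UP_pre_univ_prop.intro ring_hom_cringI h UP_cring.intro)
      (auto simp: P_def cring_axioms S.cring_axioms)
  define t where "t = (\<zero>, \<one>)"
  have t: "t \<in> carrier S"
    by (simp add: S_def t_def)
  define E where "E = eval R S h t"
  have E: "E \<in> ring_hom P S"
    unfolding E_def by (rule eval_ring_hom[OF t])
  interpret E: ring_hom_cring P S E
    by (intro ring_hom_cringI E P.cring_axioms S.cring_axioms)
  have E_monom: "E (monom P r n) = h r \<otimes>\<^bsub>S\<^esub> t [^]\<^bsub>S\<^esub> n" if "r \<in> carrier R" for r n
    unfolding E_def by (rule eval_monom[OF that t])
  define g where "g = monic_quadratic R \<zero> (\<ominus> b)"
  have g: "g = monom P \<one> 2 \<oplus>\<^bsub>P\<^esub> monom P \<zero> 1 \<oplus>\<^bsub>P\<^esub> monom P (\<ominus> b) 0"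
    unfolding g_def monic_quadratic_def P_def ..
  have gc: "g \<in> carrier P"
    unfolding g using b by simp
  have coeff_g: "coeff P g n = (if n = 2 then \<one> else if n = 0 then \<ominus> b else \<zero>)" for n
    unfolding g using b by simp
  have deg_g: "deg R g = 2"
    using gc by (intro le_antisym deg_aboveI deg_belowI) (simp_all add: coeff_g)
  have t2: "t [^]\<^bsub>S\<^esub> (2::nat) = h b"
    using b by (simp add: numeral_2_eq_2 S_def t_def h_def)
  have Eg: "E g = \<zero>\<^bsub>S\<^esub>"
    unfolding g using b t by (simp add: E_monom t2 S.r_neg)
  have "E p = \<zero>\<^bsub>S\<^esub> \<longleftrightarrow> p \<in> PIdl\<^bsub>P\<^esub> g" if p: "p \<in> carrier P" for p
  proof
    assume "p \<in> PIdl\<^bsub>P\<^esub> g"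
    then obtain q where "q \<in> carrier P" "p = q \<otimes>\<^bsub>P\<^esub> g"
      unfolding cgenideal_def by blast
    then show "E p = \<zero>\<^bsub>S\<^esub>"
      using gc Eg by simp
  next
    assume Ep: "E p = \<zero>\<^bsub>S\<^esub>"
    have "g \<noteq> \<zero>\<^bsub>P\<^esub>"
      using deg_g by auto
    then obtain q r k where q: "q \<in> carrier P" and r: "r \<in> carrier P"
      and div: "coeff P g (deg R g) [^] (k::nat) \<odot>\<^bsub>P\<^esub> p = g \<otimes>\<^bsub>P\<^esub> q \<oplus>\<^bsub>P\<^esub> r"
      and deg: "r = \<zero>\<^bsub>P\<^esub> \<or> deg R r < 2"
      using long_div_theorem[OF gc p] unfolding deg_g by blast
    have p_eq: "p = g \<otimes>\<^bsub>P\<^esub> q \<oplus>\<^bsub>P\<^esub> r"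
      using div p unfolding deg_g coeff_g by simp
    have "deg R r < 2"
      using deg by auto
    then have r_eq: "r = monom P (coeff P r 0) 0 \<oplus>\<^bsub>P\<^esub> monom P (coeff P r 1) 1"
      using r by (intro up_eqI) (auto simp: deg_aboveD)
    have "E p = E r"
      unfolding p_eq using gc q r Eg by simp
    also have "E r = (coeff P r 0, coeff P r 1)"
      using r b by (subst r_eq) (simp add: E_monom, simp add: h_def S_def t_def)
    finally have "coeff P r 0 = \<zero>" "coeff P r 1 = \<zero>"
      using Ep by (auto simp: S_def)
    then have "r = \<zero>\<^bsub>P\<^esub>"
      using r_eq by simp
    then have "p = q \<otimes>\<^bsub>P\<^esub> g"
      using p_eq gc q by (simp add: P.m_comm)
    then show "p \<in> PIdl\<^bsub>P\<^esub> g"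
      unfolding cgenideal_def using q by blast
  qed
  then show thesis
    using that[of E] E unfolding P_def S_def g_def by blast
qed

section \<open>The Rees algebra\<close>

context cring
begin

lemma ideal_power:
  assumes "ideal I R"
  shows "ideal (I [^]\<^bsub>ideals_set R\<^esub> (n::nat)) R"
proof -
  interpret M: comm_monoid "ideals_set R"
    by (rule ideals_set_is_comm_monoid)
  have "I [^]\<^bsub>ideals_set R\<^esub> n \<in> carrier (ideals_set R)"
    using assms by (intro M.nat_pow_closed) (simp add: ideals_set_def)
  then show ?thesis
    by (simp add: ideals_set_def)
qed

lemma mult_mem_ideal_power:
  assumes "ideal I R" "r \<in> I [^]\<^bsub>ideals_set R\<^esub> (m::nat)" "s \<in> I [^]\<^bsub>ideals_set R\<^esub> (n::nat)"
  shows "r \<otimes> s \<in> I [^]\<^bsub>ideals_set R\<^esub> (m + n)"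
proof -
  interpret M: comm_monoid "ideals_set R"
    by (rule ideals_set_is_comm_monoid)
  have "r \<otimes> s \<in> I [^]\<^bsub>ideals_set R\<^esub> m \<otimes>\<^bsub>ideals_set R\<^esub> I [^]\<^bsub>ideals_set R\<^esub> n"
    using assms(2,3) by (simp add: ideals_set_def ideal_prod.prod)
  also have "\<dots> = I [^]\<^bsub>ideals_set R\<^esub> (m + n)"
    using assms(1) by (intro M.nat_pow_mult) (simp add: ideals_set_def)
  finally show ?thesis .
qed

lemma finsum_mem_ideal:
  assumes "ideal A R" "finite F" "\<And>i. i \<in> F \<Longrightarrow> f i \<in> A"
  shows "finsum R f F \<in> A"
  using assms(2,3)
proof (induction F)
  case empty
  show ?case
    using ideal_zero_closed[OF assms(1)] by simp
next
  case (insert i F)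
  then have "f i \<oplus> finsum R f F \<in> A"
    by (intro ideal_add_closed[OF assms(1)]) auto
  moreover have "f \<in> F \<rightarrow> carrier R" "f i \<in> carrier R"
    using insert.prems ideal.Icarr[OF assms(1)] by auto
  ultimately show ?case
    using insert.hyps by simp
qed

lemma subring_rees:
  assumes I: "ideal I R"
  shows "subring (carrier (rees_algebra R I)) (UP R)"
proof -
  note idI = ideal_power[OF I] and multI = mult_mem_ideal_power[OF I]
    and sumI = finsum_mem_ideal[OF idI] and zeroI = ideal_zero_closed[OF idI]
    and addI = ideal_add_closed[OF idI]
  define P where "P = UP R"
  interpret UP_cring R P
    by (intro UP_cring.intro) (auto simp: P_def cring_axioms)
  let ?I = "\<lambda>n::nat. I [^]\<^bsub>ideals_set R\<^esub> n"
  let ?H = "{p \<in> carrier P. \<forall>n. coeff P p n \<in> ?I n}"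
  have "subring ?H P"
  proof (rule P.subringI)
    have "?I 0 = carrier R"
      by (simp add: ideals_set_def)
    then show "\<one>\<^bsub>P\<^esub> \<in> ?H"
      using zeroI by simp
    show "\<ominus>\<^bsub>P\<^esub> p \<in> ?H" if "p \<in> ?H" for p
      using that idI by (simp add: additive_subgroup.a_inv_closed ideal.axioms(1))
    show "p \<oplus>\<^bsub>P\<^esub> q \<in> ?H" if "p \<in> ?H" "q \<in> ?H" for p q
      using that by (simp add: addI)
    show "p \<otimes>\<^bsub>P\<^esub> q \<in> ?H" if p: "p \<in> ?H" and q: "q \<in> ?H" for p q
    proof -
      have "coeff P (p \<otimes>\<^bsub>P\<^esub> q) n \<in> ?I n" for n
      proof -
        have "(\<Oplus>i\<in>{..n}. coeff P p i \<otimes> coeff P q (n - i)) \<in> ?I n"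
        proof (rule sumI)
          fix i assume "i \<in> {..n}"
          then show "coeff P p i \<otimes> coeff P q (n - i) \<in> ?I n"
            using multI[of "coeff P p i" i "coeff P q (n - i)" "n - i"] p q
            by simp
        qed simp
        then show ?thesis
          using p q by simp
      qed
      then show ?thesis
        using p q by simp
    qed
  qed auto
  then show ?thesis
    by (simp add: rees_algebra_def P_def)
qed

end

text \<open>
  The ideal that is divided out is the kernel of the evaluation homomorphism restricted to the Rees
  algebra, and the kernel of a homomorphism into a domain is prime.
\<close>

lemma (in domain) domain_rees_quotient:
  assumes I: "ideal I R" and b: "b \<in> carrier R" "\<not> square_of_fraction b"
  shows "domain (rees_quotient R I \<zero> (\<ominus> b))"
proof -
  define H where "H = carrier (rees_algebra R I)"
  define S where "S = quadratic_extension R b"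
  have A: "rees_algebra R I = UP R\<lparr>carrier := H\<rparr>"
    by (simp add: H_def rees_algebra_def)
  have domP: "domain (UP R)"
    by (intro UP_domain.UP_domain UP_domain.intro domain_axioms)
  have sub: "subring H (UP R)"
    unfolding H_def by (rule subring_rees[OF I])
  interpret A: "domain" "UP R\<lparr>carrier := H\<rparr>"
    by (rule domain.subring_is_domain[OF domP sub])
  interpret S: "domain" S
    unfolding S_def by (rule domain_quadratic_extension[OF b])
  obtain E where E: "E \<in> ring_hom (UP R) S"
    and ker: "\<And>p. p \<in> carrier (UP R) \<Longrightarrow>
      E p = \<zero>\<^bsub>S\<^esub> \<longleftrightarrow> p \<in> PIdl\<^bsub>UP R\<^esub> (monic_quadratic R \<zero> (\<ominus> b))"
    using quadratic_evaluation[OF b(1)] unfolding S_def by blast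
  have Hc: "H \<subseteq> carrier (UP R)"
    using subringE(1)[OF sub] .
  have "E \<in> ring_hom (UP R\<lparr>carrier := H\<rparr>) S"
    using E Hc by (auto simp: ring_hom_def subset_iff)
  then interpret E: ring_hom_cring "UP R\<lparr>carrier := H\<rparr>" S E
    by (intro ring_hom_cringI A.cring_axioms S.cring_axioms)
  define K where "K = rees_ideal R I \<zero> (\<ominus> b)"
  have K: "K = a_kernel (UP R\<lparr>carrier := H\<rparr>) S E"
    using ker Hc unfolding K_def rees_ideal_def a_kernel_def' H_def[symmetric] by auto
  have "primeideal K (UP R\<lparr>carrier := H\<rparr>)"
  proof (rule primeidealI)
    show "ideal K (UP R\<lparr>carrier := H\<rparr>)"
      unfolding K by (rule E.ring.kernel_is_ideal)
    show "cring (UP R\<lparr>carrier := H\<rparr>)"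
      by (rule A.cring_axioms)
    have "\<one>\<^bsub>UP R\<^esub> \<notin> K"
      using E.hom_one unfolding K a_kernel_def' by simp
    then show "carrier (UP R\<lparr>carrier := H\<rparr>) \<noteq> K"
      using A.one_closed by auto
  next
    fix p q
    assume "p \<in> carrier (UP R\<lparr>carrier := H\<rparr>)" "q \<in> carrier (UP R\<lparr>carrier := H\<rparr>)"
      and "p \<otimes>\<^bsub>UP R\<lparr>carrier := H\<rparr>\<^esub> q \<in> K"
    then have "p \<in> H" "q \<in> H" "E p \<otimes>\<^bsub>S\<^esub> E q = \<zero>\<^bsub>S\<^esub>"
      using E.hom_mult[of p q] unfolding K a_kernel_def' by auto
    moreover have "E p \<in> carrier S" "E q \<in> carrier S"
      using calculation(1,2) E.hom_closed by auto
    ultimately have "E p = \<zero>\<^bsub>S\<^esub> \<or> E q = \<zero>\<^bsub>S\<^esub>"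
      using S.integral by blast
    then show "p \<in> K \<or> q \<in> K"
      using \<open>p \<in> H\<close> \<open>q \<in> H\<close> unfolding K a_kernel_def' by auto
  qed
  then have "domain (UP R\<lparr>carrier := H\<rparr> Quot K)"
    by (rule primeideal.quotient_is_domain)
  then show ?thesis
    unfolding rees_quotient_def A K_def .
qed

section \<open>Infinitely many integral quotients\<close>

lemma (in cring) krull_dim_ge_1_imp_nonzero_prime:
  assumes "krull_dim R \<ge> 1"
  obtains P x where "primeideal P R" "x \<in> P" "x \<noteq> \<zero>"
proof -
  obtain n P where n: "n \<noteq> 0" and P: "\<forall>i\<le>n. primeideal (P i) R" "\<forall>i<n. P i \<subset> P (Suc i)"
  proof (rule ccontr)
    assume "\<not> thesis"
    with that have "n = 0" if "\<forall>i\<le>n. primeideal (P i) R" "\<forall>i<n. P i \<subset> P (Suc i)" for n P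
      using that by blast
    then have "krull_dim R \<le> 0"
      unfolding krull_dim_def by (intro Sup_least) (auto simp: zero_enat_def)
    with assms show False
      by (metis not_one_le_zero order_trans)
  qed
  have "P 0 \<subset> P 1" "primeideal (P 0) R" "primeideal (P 1) R"
    using n P by auto
  then obtain x where "x \<in> P 1" "x \<notin> P 0"
    by blast
  moreover have "\<zero> \<in> P 0"
    using ideal_zero_closed primeideal.axioms(1) \<open>primeideal (P 0) R\<close> by blast
  ultimately show thesis
    using that[OF \<open>primeideal (P 1) R\<close>] by blast
qed

theorem corollary2p6:
  fixes R (structure) and I :: "'a set"
  assumes "noetherian_domain R"
    and "local_ring R"
    and "krull_dim R \<ge> 1"
    and "ideal I R"
  shows "infinite {b \<in> carrier R. domain (rees_quotient R I \<zero> (\<ominus> b))}"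
proof -
  interpret noetherian_domain R
    by (rule assms(1))
  obtain P x where "primeideal P R" "x \<in> P" "x \<noteq> \<zero>"
    using krull_dim_ge_1_imp_nonzero_prime[OF assms(3)] by blast
  then have "infinite {b \<in> carrier R. \<not> square_of_fraction b}"
    by (rule infinitely_many_nonsquares)
  moreover have "{b \<in> carrier R. \<not> square_of_fraction b}
      \<subseteq> {b \<in> carrier R. domain (rees_quotient R I \<zero> (\<ominus> b))}"
    using domain_rees_quotient[OF assms(4)] by blast
  ultimately show ?thesis
    by (rule infinite_super[rotated])
qed

end
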